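(* For every integer $n \ge 1$, $\mathsf{rc}(n) \le 18^n$.
   Context: A finite point set in the plane is in general position if no two of its points share the same $x$-coordinate or the same $y$-coordinate. Let $B$ be an axis-parallel rectangle and $P$ a set of $n$ points in general position in the interior of $B$. A rectangulation of $(B,P)$ is a partition of $B$ into rectangles by axis-parallel segments such that every segment contains exactly one point of $P$, each point of $P$ lies on exactly one segment, and segments do not intersect in their interiors (an endpoint of one segment may lie in the interior of another segment or on the boundary of $B$). Let $\mathsf{rc}(P)$ denote the number of rectangulations of $(B,P)$, and let $\mathsf{rc}(n)$ be the maximum of $\mathsf{rc}(P)$ over all sets $P$ of $n$ points in general position. *)

theory Defs
  imports "HOL-Analysis.Analysis" "HOL-Library.Extended_Nat"
begin

definition general_position :: "(real \<times> real) set \<Rightarrow> bool" where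
  "general_position P \<longleftrightarrow> finite P \<and> inj_on fst P \<and> inj_on snd P"

definition rectangle :: "(real \<times> real) set \<Rightarrow> bool" where
  "rectangle R \<longleftrightarrow> (\<exists>a b. R = cbox a b) \<and> interior R \<noteq> {}"

definition axis_parallel_segment :: "(real \<times> real) set \<Rightarrow> bool" where
  "axis_parallel_segment s \<longleftrightarrow>
     (\<exists>p q. s = closed_segment p q \<and> p \<noteq> q \<and> (fst p = fst q \<or> snd p = snd q))"

text \<open>
  The segments in \<open>S\<close> cut \<open>B\<close> into rectangles: \<open>B\<close> is tiled by nondegenerate
  rectangles whose boundaries together are exactly the boundary of \<open>B\<close> and the segments.
\<close>

definition partitions_into_rectangles ::
    "(real \<times> real) set set \<Rightarrow> (real \<times> real) set \<Rightarrow> bool" where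
  "partitions_into_rectangles S B \<longleftrightarrow>
     (\<exists>T. T division_of B \<and> (\<forall>R\<in>T. rectangle R) \<and>
          (\<Union>R\<in>T. frontier R) = frontier B \<union> \<Union>S)"

text \<open>
  A rectangulation is represented by its set of segments. In general position no two of them
  are collinear, so they are determined by the partition, and vice versa. The interior
  of a segment is its relative interior, i.e. the segment without its endpoints.
\<close>

definition rectangulation ::
    "(real \<times> real) set \<Rightarrow> (real \<times> real) set \<Rightarrow> (real \<times> real) set set \<Rightarrow> bool" where
  "rectangulation B P S \<longleftrightarrow>
     (\<forall>s\<in>S. axis_parallel_segment s) \<and>
     partitions_into_rectangles S B \<and>
     (\<forall>s\<in>S. \<exists>!p. p \<in> P \<and> p \<in> s) \<and>
     (\<forall>p\<in>P. \<exists>!s. s \<in> S \<and> p \<in> s) \<and>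
     (\<forall>s\<in>S. \<forall>t\<in>S. s \<noteq> t \<longrightarrow> rel_interior s \<inter> rel_interior t = {})"

text \<open>
  Counting takes values in \<^typ>\<open>enat\<close>, so that an upper bound also asserts that there are
  only finitely many rectangulations (\<^const>\<open>card\<close> of an infinite set would be 0) and that
  the supremum over all point sets is finite, hence a maximum.
\<close>

definition rc :: "(real \<times> real) set \<Rightarrow> (real \<times> real) set \<Rightarrow> enat" where
  "rc B P = (if finite {S. rectangulation B P S}
             then enat (card {S. rectangulation B P S}) else \<infinity>)"

definition rc_max :: "nat \<Rightarrow> enat" where
  "rc_max n = Sup {rc B P | B P.
     rectangle B \<and> general_position P \<and> card P = n \<and> P \<subseteq> interior B}"

end

theory Submission
  imports Defs
begin

text \<open>
  Deleting a point \<open>p\<close>, and prolonging the segments that end on the segment of \<open>p\<close> up to the next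
  obstacle, turns a rectangulation of \<open>P\<close> into one of \<open>P - {p}\<close>. Conversely, a rectangulation of
  \<open>P - {p}\<close> and the orientation of the segment of \<open>p\<close> leave only the choice of how many segments
  it meets on either side of \<open>p\<close>. The two choices are independent, so the preimages form a
  product \<open>I \<times> J\<close> of sets of naturals, and \<open>(\<Sum>i\<in>I. \<Sum>j\<in>J. 4 - (i + j)) \<le> 18\<close>, with equality for
  \<open>I = J = {0, 1, 2}\<close>; the two orientations together give at most 36. Since the \<open>n\<close> segments have
  \<open>2 * n\<close> ends, the degrees \<open>i + j\<close> of a rectangulation sum up to at most \<open>2 * n\<close>. Summing
  \<open>4 - degree\<close> over all rectangulations and all points yields
  \<open>2 * n * rc P \<le> (\<Sum>p\<in>P. 36 * rc (P - {p}))\<close>, and the bound follows by induction.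
\<close>

subsection \<open>The weight of a product set\<close>

text \<open>As \<open>4 * a * b \<le> (a + b) ^ 2\<close>, everything reduces to
  \<open>s ^ 2 * (10 - s)\<close> for an integer \<open>s\<close>. Its maximum is 147, at
  \<open>s = 7\<close>, and integrality takes 147 / 4 down to 36.\<close>

lemma mult_ten_minus_le:
  fixes a b :: nat
  shows "int a * int b * (10 - int a - int b) \<le> 36"
proof (cases "a + b < 10")
  case True
  define s where "s = int a + int b"
  have "4 * (int a * int b) \<le> s ^ 2"
    using zero_le_power2[of "int a - int b"] by (simp add: s_def power2_eq_square algebra_simps)
  then have *: "4 * (int a * int b) * (10 - s) \<le> s ^ 2 * (10 - s)"
    by (rule mult_right_mono) (use True in \<open>simp add: s_def\<close>)
  have "s = 0 \<or> s = 1 \<or> s = 2 \<or> s = 3 \<or> s = 4 \<or> s = 5 \<or> s = 6 \<or> s = 7 \<or> s = 8 \<or> s = 9"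
    using True unfolding s_def by presburger
  then have "s ^ 2 * (10 - s) \<le> 147" by auto
  with * have "4 * (int a * int b * (10 - s)) \<le> 147" by (simp only: mult.assoc)
  then have "int a * int b * (10 - s) \<le> 36" by presburger
  then show ?thesis by (simp add: s_def algebra_simps)
next
  case False
  then have "int a * int b * (10 - int a - int b) \<le> 0"
    by (intro mult_nonneg_nonpos) auto
  then show ?thesis by simp
qed

lemma double_sum_ge:
  fixes I :: "nat set"
  shows "int (card I) * (int (card I) - 1) \<le> 2 * (\<Sum>i\<in>I. int i)"
proof -
  have "int (2 * (\<Sum>{0..<n})) = int n * (int n - 1)" for n :: nat
    by (induction n) (auto simp: algebra_simps)
  then have "int (card I) * (int (card I) - 1) = int (2 * (\<Sum>{0..<card I}))" by simp
  also have "\<dots> \<le> int (2 * \<Sum>I)"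
    using card_sum_le_nat_sum[of I] by (simp only: of_nat_le_iff)
  finally show ?thesis by simp
qed

text \<open>By \<open>closed\<close> the pairs \<open>(i c, j c)\<close> fill a whole product
  \<open>I \<times> J\<close>. For given sizes \<open>a\<close> and \<open>b\<close> of the factors
  the smallest entries are the worst case, and twice the sum is then
  \<open>a * b * (10 - a - b)\<close>.\<close>

lemma sum_product_image_le:
  fixes F :: "'a set" and i j :: "'a \<Rightarrow> nat"
  assumes "finite F" and inj: "inj_on (\<lambda>c. (i c, j c)) F"
    and closed: "\<And>c d. c \<in> F \<Longrightarrow> d \<in> F \<Longrightarrow> \<exists>e\<in>F. i e = i c \<and> j e = j d"
  shows "(\<Sum>c\<in>F. 4 - int (i c + j c)) \<le> 18"
proof -
  define I J a b where "I = i ` F" and "J = j ` F" and "a = int (card I)" and "b = int (card J)"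
  have fin: "finite I" "finite J" using assms by (auto simp: I_def J_def)
  have "(\<lambda>c. (i c, j c)) ` F = I \<times> J"
  proof (intro equalityI subsetI)
    fix z assume "z \<in> I \<times> J"
    then obtain c d where "c \<in> F" "d \<in> F" "z = (i c, j d)" by (auto simp: I_def J_def)
    with closed[of c d] show "z \<in> (\<lambda>c. (i c, j c)) ` F" by (auto simp: image_iff) metis
  qed (auto simp: I_def J_def)
  then have "(\<Sum>c\<in>F. 4 - int (i c + j c)) = (\<Sum>(x, y)\<in>I \<times> J. 4 - int (x + y))"
    using sum.reindex[OF inj, of "\<lambda>(x, y). 4 - int (x + y)"] by simp
  also have "\<dots> = (\<Sum>x\<in>I. \<Sum>y\<in>J. 4 - int x - int y)"
    by (subst sum.cartesian_product[symmetric]) (simp add: algebra_simps)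
  also have "\<dots> = 4 * a * b - b * (\<Sum>x\<in>I. int x) - a * (\<Sum>y\<in>J. int y)"
    by (simp add: sum_subtractf sum.distrib sum_distrib_left sum_distrib_right a_def b_def algebra_simps)
  finally have eq: "2 * (\<Sum>c\<in>F. 4 - int (i c + j c)) =
      8 * a * b - b * (2 * (\<Sum>x\<in>I. int x)) - a * (2 * (\<Sum>y\<in>J. int y))"
    by (simp add: algebra_simps)
  have "b * (a * (a - 1)) \<le> b * (2 * (\<Sum>x\<in>I. int x))"
    unfolding a_def b_def by (intro mult_left_mono double_sum_ge) auto
  moreover have "a * (b * (b - 1)) \<le> a * (2 * (\<Sum>y\<in>J. int y))"
    unfolding a_def b_def by (intro mult_left_mono double_sum_ge) auto
  moreover have "a * b * (10 - a - b) \<le> 36"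
    unfolding a_def b_def by (rule mult_ten_minus_le)
  ultimately show ?thesis using eq by (simp add: algebra_simps)
qed

subsection \<open>Combinatorial rectangulations\<close>

text \<open>A Boolean names an axis, \<open>True\<close> the horizontal one, so that one argument
  covers both directions, with \<open>b\<close> and \<open>\<not> b\<close> for along and
  across.\<close>

definition coord :: "bool \<Rightarrow> real \<times> real \<Rightarrow> real" where
  "coord b q = (if b then fst q else snd q)"

text \<open>
  A configuration maps each point to the direction of its segment (\<^const>\<open>True\<close> for horizontal)
  and to the two ends of the segment, measured along that direction.
\<close>

type_synonym config = "real \<times> real \<Rightarrow> bool \<times> real \<times> real"

abbreviation ori :: "config \<Rightarrow> real \<times> real \<Rightarrow> bool" where "ori c q \<equiv> fst (c q)"
abbreviation lo :: "config \<Rightarrow> real \<times> real \<Rightarrow> real" where "lo c q \<equiv> fst (snd (c q))"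
abbreviation hi :: "config \<Rightarrow> real \<times> real \<Rightarrow> real" where "hi c q \<equiv> snd (snd (c q))"

text \<open>For perpendicular segments: the line carrying the segment of \<open>q\<close> crosses
  that of \<open>h\<close> strictly between its ends. For \<open>h = q\<close>: the point is
  strictly inside its own segment.\<close>

definition spans :: "config \<Rightarrow> real \<times> real \<Rightarrow> real \<times> real \<Rightarrow> bool" where
  "spans c h q \<longleftrightarrow> lo c h < coord (ori c h) q \<and> coord (ori c h) q < hi c h"

text \<open>Rectangulations without topology: each end lies on a side of the box or strictly inside
  a perpendicular segment, and no two segments cross. Values outside \<open>P\<close> are fixed by
  \<open>extensional\<close>, so distinct configurations differ on \<open>P\<close>.\<close>

definition configs ::
    "(bool \<Rightarrow> real) \<Rightarrow> (bool \<Rightarrow> real) \<Rightarrow> (real \<times> real) set \<Rightarrow> config set" where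
  "configs L U P = {c \<in> extensional P. \<forall>q\<in>P.
     spans c q q \<and>
     (lo c q = L (ori c q) \<or>
       (\<exists>h\<in>P. ori c h \<noteq> ori c q \<and> lo c q = coord (ori c q) h \<and> spans c h q)) \<and>
     (hi c q = U (ori c q) \<or>
       (\<exists>h\<in>P. ori c h \<noteq> ori c q \<and> hi c q = coord (ori c q) h \<and> spans c h q)) \<and>
     (\<forall>h\<in>P. ori c h \<noteq> ori c q \<longrightarrow> \<not> (spans c h q \<and> spans c q h))}"

lemma configsD:
  assumes "c \<in> configs L U P"
  shows "c \<in> extensional P"
    and "q \<in> P \<Longrightarrow> spans c q q"
    and "q \<in> P \<Longrightarrow> lo c q = L (ori c q) \<or>
       (\<exists>h\<in>P. ori c h \<noteq> ori c q \<and> lo c q = coord (ori c q) h \<and> spans c h q)"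
    and "q \<in> P \<Longrightarrow> hi c q = U (ori c q) \<or>
       (\<exists>h\<in>P. ori c h \<noteq> ori c q \<and> hi c q = coord (ori c q) h \<and> spans c h q)"
    and "q \<in> P \<Longrightarrow> h \<in> P \<Longrightarrow> ori c h \<noteq> ori c q \<Longrightarrow> \<not> (spans c h q \<and> spans c q h)"
  using assms unfolding configs_def by blast+

locale points_in_box =
  fixes P :: "(real \<times> real) set" and L U :: "bool \<Rightarrow> real"
  assumes fin: "finite P"
    and inj: "\<And>b. inj_on (coord b) P"
    and bounds: "\<And>b q. q \<in> P \<Longrightarrow> L b < coord b q \<and> coord b q < U b"
begin

lemma coord_eqD: "coord b q = coord b h \<Longrightarrow> q \<in> P \<Longrightarrow> h \<in> P \<Longrightarrow> q = h"
  using inj by (metis inj_onD)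

lemma remove: "points_in_box (P - {p}) L U"
  by unfold_locales (auto intro: inj_on_subset[OF inj] simp: fin bounds)

lemma finite_configs: "finite (configs L U P)"
proof -
  define V where "V b = insert (L b) (insert (U b) (coord b ` P))" for b
  define W where "W = V True \<union> V False"
  have V: "V b \<subseteq> W" for b by (cases b) (auto simp: W_def)
  have "lo c q \<in> V (ori c q) \<and> hi c q \<in> V (ori c q)" if "c \<in> configs L U P" "q \<in> P" for c q
    using configsD(3,4)[OF that] by (auto simp: V_def)
  then have "configs L U P \<subseteq> PiE P (\<lambda>_. UNIV \<times> W \<times> W)"
    using V configsD(1) by (force simp: PiE_def Pi_def mem_Times_iff)
  moreover have "finite \<dots>"
    by (intro finite_PiE fin finite_cartesian_product) (auto simp: W_def V_def fin)
  ultimately show ?thesis by (rule finite_subset)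
qed

text \<open>A point lies strictly inside the box and shares no coordinate with another one, so only
  the segment of \<open>p\<close> can be what stops this end.\<close>

lemma lo_eqD:
  assumes "c \<in> configs L U P" "q \<in> P" "p \<in> P" "lo c q = coord (ori c q) p"
  shows "ori c q \<noteq> ori c p" "spans c p q"
  using configsD(3)[OF assms(1,2)] bounds[OF assms(3)] assms(3,4) coord_eqD
  by (metis less_irrefl)+

lemma hi_eqD:
  assumes "c \<in> configs L U P" "q \<in> P" "p \<in> P" "hi c q = coord (ori c q) p"
  shows "ori c q \<noteq> ori c p" "spans c p q"
  using configsD(4)[OF assms(1,2)] bounds[OF assms(3)] assms(3,4) coord_eqD
  by (metis less_irrefl)+

lemma lo_ge: "c \<in> configs L U P \<Longrightarrow> q \<in> P \<Longrightarrow> L (ori c q) \<le> lo c q"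
  using configsD(3) bounds by (metis order_less_imp_le order_refl)

lemma hi_le: "c \<in> configs L U P \<Longrightarrow> q \<in> P \<Longrightarrow> hi c q \<le> U (ori c q)"
  using configsD(4) bounds by (metis order_less_imp_le order_refl)

text \<open>The segment of \<open>q\<close> ends on that of \<open>p\<close>; in a configuration the
  coordinate decides this, by \<open>lo_eqD\<close> and \<open>hi_eqD\<close>.\<close>

definition touches :: "config \<Rightarrow> real \<times> real \<Rightarrow> real \<times> real \<Rightarrow> bool" where
  "touches c p q \<longleftrightarrow> lo c q = coord (ori c q) p \<or> hi c q = coord (ori c q) p"

definition degree :: "config \<Rightarrow> real \<times> real \<Rightarrow> nat" where
  "degree c p = card {q \<in> P. touches c p q}"

lemma sum_degree_le: "(\<Sum>p\<in>P. degree c p) \<le> 2 * card P"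
proof -
  have "(\<Sum>p\<in>P. degree c p) = (\<Sum>p\<in>P. \<Sum>q\<in>P. if touches c p q then 1 else 0)"
    by (auto simp: degree_def fin sum.If_cases intro!: sum.cong arg_cong[where f = card])
  also have "\<dots> = (\<Sum>q\<in>P. \<Sum>p\<in>P. if touches c p q then 1 else 0)"
    by (rule sum.swap)
  also have "\<dots> = (\<Sum>q\<in>P. card {p \<in> P. touches c p q})"
    by (auto simp: fin sum.If_cases intro!: sum.cong arg_cong[where f = card])
  also have "\<dots> \<le> (\<Sum>q\<in>P. 2)"
  proof (rule sum_mono)
    fix q
    have "card {p \<in> P. touches c p q} = card (coord (ori c q) ` {p \<in> P. touches c p q})"
      by (rule card_image[symmetric]) (rule inj_on_subset[OF inj], auto)
    also have "\<dots> \<le> card {lo c q, hi c q}"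
      by (rule card_mono) (auto simp: touches_def)
    also have "\<dots> \<le> 2" by (simp add: card_insert_if)
    finally show "card {p \<in> P. touches c p q} \<le> 2" .
  qed
  finally show ?thesis by simp
qed

subsection \<open>Deleting a point\<close>

text \<open>Where the lower end of the segment of \<open>q\<close> can stop once \<open>p\<close> is
  gone: at the side of the box or at a perpendicular segment beyond \<open>p\<close> in its way. The
  nearest obstacle is the maximum, for \<open>above\<close> the minimum.\<close>

definition below :: "config \<Rightarrow> real \<times> real \<Rightarrow> real \<times> real \<Rightarrow> real set" where
  "below c p q = insert (L (ori c q)) (coord (ori c q) `
     {h \<in> P - {p}. ori c h \<noteq> ori c q \<and> coord (ori c q) h < coord (ori c q) p \<and> spans c h q})"

definition above :: "config \<Rightarrow> real \<times> real \<Rightarrow> real \<times> real \<Rightarrow> real set" where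
  "above c p q = insert (U (ori c q)) (coord (ori c q) `
     {h \<in> P - {p}. ori c h \<noteq> ori c q \<and> coord (ori c q) p < coord (ori c q) h \<and> spans c h q})"

text \<open>Only segments perpendicular to that of \<open>p\<close> move, and their obstacles are
  parallel to it and stay fixed. Hence all prolongations can be made at once, with obstacles read
  off from \<open>c\<close>.\<close>

definition remove_pt :: "real \<times> real \<Rightarrow> config \<Rightarrow> config" where
  "remove_pt p c = (\<lambda>q\<in>P - {p}.
     (ori c q,
      if lo c q = coord (ori c q) p then Max (below c p q) else lo c q,
      if hi c q = coord (ori c q) p then Min (above c p q) else hi c q))"

lemma remove_pt_simps:
  assumes "q \<in> P - {p}"
  shows "ori (remove_pt p c) q = ori c q"
    "lo (remove_pt p c) q = (if lo c q = coord (ori c q) p then Max (below c p q) else lo c q)"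
    "hi (remove_pt p c) q = (if hi c q = coord (ori c q) p then Min (above c p q) else hi c q)"
  using assms by (auto simp: remove_pt_def)

lemma finite_below: "finite (below c p q)" and finite_above: "finite (above c p q)"
  by (auto simp: below_def above_def fin)

lemma Max_below_less: "p \<in> P \<Longrightarrow> Max (below c p q) < coord (ori c q) p"
  by (subst Max_less_iff) (auto simp: finite_below, auto simp: below_def bounds)

lemma Min_above_greater: "p \<in> P \<Longrightarrow> coord (ori c q) p < Min (above c p q)"
  by (subst Min_gr_iff) (auto simp: finite_above, auto simp: above_def bounds)

lemma remove_pt_parallel:
  assumes "c \<in> configs L U P" "p \<in> P" "q \<in> P - {p}" "ori c q = ori c p"
  shows "remove_pt p c q = c q"
  using assms lo_eqD(1)[of c q p] hi_eqD(1)[of c q p]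
  by (auto simp: prod_eq_iff remove_pt_simps)

lemma remove_pt_larger:
  assumes "p \<in> P" "q \<in> P - {p}"
  shows "lo (remove_pt p c) q \<le> lo c q" "hi c q \<le> hi (remove_pt p c) q"
  using Max_below_less[OF assms(1)] Min_above_greater[OF assms(1)] assms
  by (auto simp: remove_pt_simps less_imp_le)

lemma spans_remove_pt:
  assumes "p \<in> P" "h \<in> P - {p}" "spans c h q"
  shows "spans (remove_pt p c) h q"
  using remove_pt_larger[OF assms(1,2), of c] assms(3)
  by (auto simp: spans_def remove_pt_simps(1)[OF assms(2)])

text \<open>A prolonged end lies on the obstacle where the extremum is attained. A new crossing
  would have to lie on a prolonged part, but then the crossed segment would be a nearer obstacle
  than the one chosen.\<close>

lemma remove_pt_in_configs:
  assumes c: "c \<in> configs L U P" and p: "p \<in> P"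
  shows "remove_pt p c \<in> configs L U (P - {p})"
proof -
  let ?c = "remove_pt p c"
  have lo_end: "lo ?c q = L (ori ?c q) \<or>
      (\<exists>h\<in>P - {p}. ori ?c h \<noteq> ori ?c q \<and> lo ?c q = coord (ori ?c q) h \<and> spans ?c h q)"
    if q: "q \<in> P - {p}" for q
  proof (cases "lo c q = coord (ori c q) p")
    case True
    have "Max (below c p q) \<in> below c p q"
      by (rule Max_in) (auto simp: finite_below, auto simp: below_def)
    then show ?thesis using q True p
      by (auto simp: remove_pt_simps below_def intro: spans_remove_pt)
  next
    case False
    then show ?thesis using configsD(3)[OF c, of q] q p
      by (auto simp: remove_pt_simps intro: spans_remove_pt)
  qed
  have hi_end: "hi ?c q = U (ori ?c q) \<or>
      (\<exists>h\<in>P - {p}. ori ?c h \<noteq> ori ?c q \<and> hi ?c q = coord (ori ?c q) h \<and> spans ?c h q)"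
    if q: "q \<in> P - {p}" for q
  proof (cases "hi c q = coord (ori c q) p")
    case True
    have "Min (above c p q) \<in> above c p q"
      by (rule Min_in) (auto simp: finite_above, auto simp: above_def)
    then show ?thesis using q True p
      by (auto simp: remove_pt_simps above_def intro: spans_remove_pt)
  next
    case False
    then show ?thesis using configsD(4)[OF c, of q] q p
      by (auto simp: remove_pt_simps intro: spans_remove_pt)
  qed
  have nocross: False
    if q: "q \<in> P - {p}" and h: "h \<in> P - {p}" and o: "ori c q \<noteq> ori c p" "ori c h = ori c p"
      and s: "spans ?c h q" "spans ?c q h" for q h
  proof -
    have sh: "spans c h q"
      using s(1) remove_pt_parallel[OF c p h o(2)] by (simp add: spans_def)
    then have "\<not> spans c q h"
      using configsD(5)[OF c, of q h] o q h by auto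
    then consider "coord (ori c q) h \<le> lo c q" | "hi c q \<le> coord (ori c q) h"
      by (auto simp: spans_def not_less)
    then show False
    proof cases
      case 1
      with s(2) q have lo: "lo c q = coord (ori c q) p"
        by (auto simp: spans_def remove_pt_simps split: if_splits)
      with 1 coord_eqD[of "ori c q" h p] h p have "coord (ori c q) h < coord (ori c q) p"
        by fastforce
      then have "coord (ori c q) h \<in> below c p q"
        using h o sh by (auto simp: below_def)
      then have "coord (ori c q) h \<le> Max (below c p q)"
        by (rule Max_ge[OF finite_below])
      with s(2) lo q show False by (auto simp: spans_def remove_pt_simps)
    next
      case 2
      with s(2) q have hi: "hi c q = coord (ori c q) p"
        by (auto simp: spans_def remove_pt_simps split: if_splits)
      with 2 coord_eqD[of "ori c q" h p] h p have "coord (ori c q) p < coord (ori c q) h"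
        by fastforce
      then have "coord (ori c q) h \<in> above c p q"
        using h o sh by (auto simp: above_def)
      then have "Min (above c p q) \<le> coord (ori c q) h"
        by (rule Min_le[OF finite_above])
      with s(2) hi q show False by (auto simp: spans_def remove_pt_simps)
    qed
  qed
  have "\<not> (spans ?c h q \<and> spans ?c q h)"
    if "q \<in> P - {p}" "h \<in> P - {p}" "ori ?c h \<noteq> ori ?c q" for q h
    using nocross[of q h] nocross[of h q] that by (auto simp: remove_pt_simps)
  moreover have "?c \<in> extensional (P - {p})"
    by (simp add: remove_pt_def)
  moreover have "spans ?c q q" if "q \<in> P - {p}" for q
    using spans_remove_pt[OF p that] configsD(2)[OF c, of q] that by auto
  ultimately show ?thesis using lo_end hi_end unfolding configs_def by blast
qed

section \<open>The degree of a point in terms of its deletion\<close>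

text \<open>The right-hand side depends only on the deletion and on the segment of \<open>p\<close>.
  An end resting on that segment is moved past it; conversely, as \<open>c\<close> has no crossing,
  a segment that would cross that of \<open>p\<close> after the deletion must have been stopped by
  it.\<close>

lemma touches_iff:
  assumes c: "c \<in> configs L U P" and p: "p \<in> P" and q: "q \<in> P"
  shows "touches c p q \<longleftrightarrow>
    q \<noteq> p \<and> ori (remove_pt p c) q \<noteq> ori c p \<and> spans (remove_pt p c) q p \<and> spans c p q"
proof (cases "q = p")
  case True
  then show ?thesis using lo_eqD[OF c q p] hi_eqD[OF c q p] by (auto simp: touches_def)
next
  case False
  with q have q': "q \<in> P - {p}" by simp
  show ?thesis
  proof
    assume t: "touches c p q"
    have "ori c q \<noteq> ori c p" "spans c p q"
      using t lo_eqD[OF c q p] hi_eqD[OF c q p] by (auto simp: touches_def)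
    moreover have "spans (remove_pt p c) q p"
    proof -
      have "lo c q < hi c q" using configsD(2)[OF c q] by (simp add: spans_def)
      with t show ?thesis
        using Max_below_less[OF p, of c q] Min_above_greater[OF p, of c q]
        by (auto simp: touches_def spans_def remove_pt_simps[OF q'])
    qed
    ultimately show "q \<noteq> p \<and> ori (remove_pt p c) q \<noteq> ori c p \<and> spans (remove_pt p c) q p \<and> spans c p q"
      using False q' by (simp add: remove_pt_simps)
  next
    assume a: "q \<noteq> p \<and> ori (remove_pt p c) q \<noteq> ori c p \<and> spans (remove_pt p c) q p \<and> spans c p q"
    then have "\<not> spans c q p"
      using configsD(5)[OF c q p] q' by (auto simp: remove_pt_simps)
    then show "touches c p q"
      using a q' by (auto simp: touches_def spans_def remove_pt_simps split: if_splits)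
  qed
qed

text \<open>Segments that, after the deletion, cross the line through \<open>p\<close> in direction
  \<open>ori c p\<close>. Only \<open>remove_pt p c\<close> and \<open>ori c p\<close> enter, so the
  set is constant on each fibre.\<close>

definition crossed :: "config \<Rightarrow> real \<times> real \<Rightarrow> (real \<times> real) set" where
  "crossed c p =
     {q \<in> P - {p}. ori (remove_pt p c) q \<noteq> ori c p \<and> spans (remove_pt p c) q p}"

text \<open>The strict bound at \<open>lo c p\<close> leaves out the segment on which that of
  \<open>p\<close> itself ends.\<close>

definition deg_lo :: "real \<times> real \<Rightarrow> config \<Rightarrow> nat" where
  "deg_lo p c = card {q \<in> crossed c p.
     lo c p < coord (ori c p) q \<and> coord (ori c p) q < coord (ori c p) p}"

definition deg_hi :: "real \<times> real \<Rightarrow> config \<Rightarrow> nat" where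
  "deg_hi p c = card {q \<in> crossed c p.
     coord (ori c p) p < coord (ori c p) q \<and> coord (ori c p) q < hi c p}"

lemma finite_crossed: "finite (crossed c p)"
  by (simp add: crossed_def fin)

lemma degree_split:
  assumes c: "c \<in> configs L U P" and p: "p \<in> P"
  shows "degree c p = deg_lo p c + deg_hi p c"
proof -
  let ?A = "{q \<in> crossed c p. lo c p < coord (ori c p) q \<and> coord (ori c p) q < coord (ori c p) p}"
  let ?B = "{q \<in> crossed c p. coord (ori c p) p < coord (ori c p) q \<and> coord (ori c p) q < hi c p}"
  have "coord (ori c p) q \<noteq> coord (ori c p) p" if "q \<in> crossed c p" for q
    using that coord_eqD[of "ori c p" q p] p by (auto simp: crossed_def)
  moreover have "lo c p < coord (ori c p) p" "coord (ori c p) p < hi c p"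
    using configsD(2)[OF c p] by (auto simp: spans_def)
  ultimately have "{q \<in> P. touches c p q} = ?A \<union> ?B"
    using touches_iff[OF c p] by (fastforce simp: crossed_def spans_def)
  moreover have "card (?A \<union> ?B) = card ?A + card ?B"
    by (rule card_Un_disjoint) (auto simp: finite_crossed)
  ultimately show ?thesis by (simp add: degree_def deg_lo_def deg_hi_def)
qed

lemma mem_crossed:
  assumes "c \<in> configs L U P" "p \<in> P" "h \<in> P" "ori c h \<noteq> ori c p" "spans c h p"
  shows "h \<in> crossed c p"
  using assms spans_remove_pt[of p h c p] remove_pt_simps(1)[of h p c]
  by (auto simp: crossed_def)

text \<open>The lower end in \<open>d\<close> is not on the box, as that in \<open>c\<close> is
  lower still. So it rests on a crossed segment, which counts for \<open>c\<close> but not for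
  \<open>d\<close>. Within a fibre the count thus determines the end.\<close>

lemma deg_lo_less:
  assumes c: "c \<in> configs L U P" and d: "d \<in> configs L U P" and p: "p \<in> P"
    and eq: "crossed c p = crossed d p" "ori c p = ori d p" and less: "lo c p < lo d p"
  shows "deg_lo p d < deg_lo p c"
proof -
  obtain h where h: "h \<in> P" "ori d h \<noteq> ori d p" "lo d p = coord (ori d p) h" "spans d h p"
    using configsD(3)[OF d p] lo_ge[OF c p] less eq by auto
  have "h \<in> crossed d p" by (rule mem_crossed[OF d p h(1,2,4)])
  moreover have "lo d p < coord (ori d p) p" using configsD(2)[OF d p] by (simp add: spans_def)
  ultimately show ?thesis
    unfolding deg_lo_def using less h(3) eq
    by (intro psubset_card_mono) (auto simp: finite_crossed)
qed

lemma deg_hi_less: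
  assumes c: "c \<in> configs L U P" and d: "d \<in> configs L U P" and p: "p \<in> P"
    and eq: "crossed c p = crossed d p" "ori c p = ori d p" and less: "hi d p < hi c p"
  shows "deg_hi p d < deg_hi p c"
proof -
  obtain h where h: "h \<in> P" "ori d h \<noteq> ori d p" "hi d p = coord (ori d p) h" "spans d h p"
    using configsD(4)[OF d p] hi_le[OF c p] less eq by auto
  have "h \<in> crossed d p" by (rule mem_crossed[OF d p h(1,2,4)])
  moreover have "coord (ori d p) p < hi d p" using configsD(2)[OF d p] by (simp add: spans_def)
  ultimately show ?thesis
    unfolding deg_hi_def using less h(3) eq
    by (intro psubset_card_mono) (auto simp: finite_crossed)
qed

text \<open>Since \<open>q\<close> is strictly inside its segment, the side of \<open>p\<close> on
  which \<open>q\<close> lies decides which end touches.\<close>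

lemma touches_end:
  assumes "c \<in> configs L U P" "q \<in> P" "touches c p q"
  shows "lo c q = coord (ori c q) p \<longleftrightarrow> coord (ori c q) p < coord (ori c q) q"
    and "hi c q = coord (ori c q) p \<longleftrightarrow> coord (ori c q) q < coord (ori c q) p"
  using configsD(2)[OF assms(1,2)] assms(3) by (auto simp: touches_def spans_def)

text \<open>Deletion can be undone when the segment of \<open>p\<close> is known:
  \<open>touches_iff\<close> tells which segments to cut back to \<open>p\<close> and
  \<open>touches_end\<close> at which end; the others never changed.\<close>

lemma config_eqI:
  assumes c: "c \<in> configs L U P" and d: "d \<in> configs L U P" and p: "p \<in> P"
    and r: "remove_pt p c = remove_pt p d" and eq: "c p = d p"
  shows "c = d"
proof (rule extensionalityI[OF configsD(1)[OF c] configsD(1)[OF d]])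
  fix q assume q: "q \<in> P"
  show "c q = d q"
  proof (cases "q = p")
    case True
    then show ?thesis using eq by simp
  next
    case False
    with q have q': "q \<in> P - {p}" by simp
    have o: "ori c q = ori d q" using r remove_pt_simps(1)[OF q'] by metis
    have "touches c p q = touches d p q"
      using touches_iff[OF c p q] touches_iff[OF d p q] r eq by (simp add: spans_def)
    moreover have "c q = d q" if "touches c p q" "touches d p q"
    proof -
      have "(lo c q = coord (ori c q) p) = (lo d q = coord (ori c q) p)"
        "(hi c q = coord (ori c q) p) = (hi d q = coord (ori c q) p)"
        using touches_end[OF c q that(1)] touches_end[OF d q that(2)] o by simp_all
      then show ?thesis
        using o remove_pt_simps(2,3)[OF q', of c] remove_pt_simps(2,3)[OF q', of d] r
        by (auto simp: prod_eq_iff split: if_splits)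
    qed
    moreover have "c q = d q" if "\<not> touches c p q" "\<not> touches d p q"
      using that o remove_pt_simps(2,3)[OF q', of c] remove_pt_simps(2,3)[OF q', of d] r
      by (auto simp: prod_eq_iff touches_def)
    ultimately show ?thesis by blast
  qed
qed

subsection \<open>The preimages of a deletion form a product\<close>

text \<open>The box is cut through \<open>p\<close> across its segment: points on the lower side
  follow \<open>c\<close>, those on the upper side follow \<open>d\<close>, and the segment of
  \<open>p\<close> is joined from its lower half in \<open>c\<close> and its upper half in
  \<open>d\<close>.\<close>

definition splice :: "real \<times> real \<Rightarrow> config \<Rightarrow> config \<Rightarrow> config" where
  "splice p c d = (\<lambda>q\<in>P. if coord (ori c p) q < coord (ori c p) p then c q
     else if q = p then (ori c p, lo c p, hi d p) else d q)"

context
  fixes p c d b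
  assumes c: "c \<in> configs L U P" and d: "d \<in> configs L U P" and p: "p \<in> P"
    and r: "remove_pt p c = remove_pt p d" and b: "ori c p = b" "ori d p = b"
begin

lemma splice_less: "q \<in> P \<Longrightarrow> coord b q < coord b p \<Longrightarrow> splice p c d q = c q"
  and splice_greater: "q \<in> P \<Longrightarrow> coord b p < coord b q \<Longrightarrow> splice p c d q = d q"
  and splice_self: "splice p c d p = (b, lo c p, hi d p)"
  using p by (auto simp: splice_def b)

lemma splice_cases:
  assumes "q \<in> P"
  obtains "q = p" | "coord b q < coord b p" | "coord b p < coord b q"
  using assms coord_eqD[of b q p] p by (meson linorder_neqE)

lemma ori_eq: "q \<in> P \<Longrightarrow> ori c q = ori d q"
  using remove_pt_simps(1)[of q p c] remove_pt_simps(1)[of q p d] r b by (cases "q = p") auto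

lemma splice_ori: "q \<in> P \<Longrightarrow> ori (splice p c d) q = ori c q"
  by (rule splice_cases[of q]) (auto simp: splice_less splice_greater splice_self b ori_eq)

lemma parallel_eq:
  assumes "q \<in> P - {p}" "ori c q = b"
  shows "c q = d q" "splice p c d q = c q"
proof -
  show *: "c q = d q"
    using remove_pt_parallel[OF c p assms(1)] remove_pt_parallel[OF d p assms(1)]
      ori_eq[of q] assms r b by simp
  show "splice p c d q = c q"
    using assms(1) by (auto intro: splice_cases[of q] simp: splice_less splice_greater *)
qed

lemma spans_less: "q \<in> P \<Longrightarrow> coord b q < coord b p \<Longrightarrow> spans (splice p c d) p q = spans c p q"
  and spans_greater: "q \<in> P \<Longrightarrow> coord b p < coord b q \<Longrightarrow> spans (splice p c d) p q = spans d p q"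
  using configsD(2)[OF c p] configsD(2)[OF d p] b by (auto simp: spans_def splice_self)

text \<open>A segment perpendicular to that of \<open>p\<close> interacts only with those in
  direction \<open>b\<close>. Apart from that of \<open>p\<close> these are common to
  \<open>c\<close> and \<open>d\<close>, and of the segment of \<open>p\<close> only the half on its
  own side matters. So it sees the same surroundings as in the configuration it was taken
  from.\<close>

lemma splice_in_configs: "splice p c d \<in> configs L U P"
proof -
  let ?e = "splice p c d"
  have side: "\<exists>f. f \<in> {c, d} \<and> f \<in> configs L U P \<and> ?e q = f q \<and>
      (\<forall>h\<in>P. ori c h = b \<longrightarrow> spans ?e h q = spans f h q)"
    if q: "q \<in> P" "ori c q \<noteq> b" for q
  proof -
    have qp: "q \<noteq> p" using q b by auto
    have other: "spans ?e h q = spans c h q \<and> spans c h q = spans d h q"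
      if "h \<in> P" "h \<noteq> p" "ori c h = b" for h
      using parallel_eq[of h] that by (simp add: spans_def)
    from q(1) show ?thesis
    proof (cases rule: splice_cases)
      case 1
      with qp show ?thesis by simp
    next
      case 2
      then have "\<forall>h\<in>P. ori c h = b \<longrightarrow> spans ?e h q = spans c h q"
        using other spans_less[OF q(1)] by metis
      with 2 show ?thesis using c splice_less[OF q(1)] by blast
    next
      case 3
      then have "\<forall>h\<in>P. ori c h = b \<longrightarrow> spans ?e h q = spans d h q"
        using other spans_greater[OF q(1)] by metis
      with 3 show ?thesis using d splice_greater[OF q(1)] by blast
    qed
  qed
  have ends: "(lo ?e q = L (ori ?e q) \<or>
       (\<exists>h\<in>P. ori ?e h \<noteq> ori ?e q \<and> lo ?e q = coord (ori ?e q) h \<and> spans ?e h q)) \<and>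
     (hi ?e q = U (ori ?e q) \<or>
       (\<exists>h\<in>P. ori ?e h \<noteq> ori ?e q \<and> hi ?e q = coord (ori ?e q) h \<and> spans ?e h q))"
    if q: "q \<in> P" for q
  proof (cases "ori c q = b")
    case False
    obtain f where f: "f \<in> {c, d}" "f \<in> configs L U P" "?e q = f q"
      "\<forall>h\<in>P. ori c h = b \<longrightarrow> spans ?e h q = spans f h q"
      using side[OF q False] by blast
    have o: "ori f h = ori ?e h" if "h \<in> P" for h
      using f(1) that by (auto simp: splice_ori ori_eq)
    have "spans ?e h q = spans f h q" if "h \<in> P" "ori ?e h \<noteq> ori ?e q" for h
      using f(4) that q False by (auto simp: splice_ori)
    then have "\<exists>h\<in>P. ori ?e h \<noteq> ori ?e q \<and> x = coord (ori ?e q) h \<and> spans ?e h q"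
      if "\<exists>h\<in>P. ori f h \<noteq> ori f q \<and> x = coord (ori f q) h \<and> spans f h q" for x
      using that o q by auto
    from this[of "lo f q"] this[of "hi f q"] show ?thesis
      using configsD(3,4)[OF f(2) q] unfolding f(3) by argo
  next
    case True
    \<comment> \<open>An end stopped at \<open>x\<close> in both \<open>c\<close> and
      \<open>d\<close> is stopped by the same \<open>h\<close>, by general position, and hence also
      in \<open>?e\<close>, whichever of the two \<open>h\<close> follows.\<close>
    have perp: "\<exists>h\<in>P. ori ?e h \<noteq> ori ?e q \<and> x = coord (ori ?e q) h \<and> spans ?e h q"
      if ex: "\<exists>h\<in>P. ori c h \<noteq> ori c q \<and> x = coord (ori c q) h \<and> spans c h q"
        "\<exists>h\<in>P. ori d h \<noteq> ori d q \<and> x = coord (ori d q) h \<and> spans d h q" for x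
    proof -
      obtain h where h: "h \<in> P" "ori c h \<noteq> ori c q" "x = coord (ori c q) h" "spans c h q"
        using ex(1) by blast
      obtain k where k: "k \<in> P" "x = coord (ori d q) k" "spans d k q"
        using ex(2) by blast
      have "h = k" using h(1,3) k(1,2) coord_eqD[of "ori c q" h k] ori_eq[OF q] by simp
      moreover obtain f where "f \<in> {c, d}" "?e h = f h"
        using side[OF h(1)] h(2) True by metis
      ultimately have "spans ?e h q" using h k by (auto simp: spans_def)
      then show ?thesis using h q by (auto simp: splice_ori)
    qed
    show ?thesis
    proof (cases "q = p")
      case False
      then have e: "?e q = c q" "c q = d q" using parallel_eq[of q] q True by auto
      then show ?thesis
        using configsD(3,4)[OF c q] configsD(3,4)[OF d q, folded e(2)]
          perp[of "lo c q", folded e(2)] perp[of "hi c q", folded e(2)]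
        unfolding e(1) by argo
    next
      case q: True
      \<comment> \<open>A segment that stops the lower end lies on the lower side of
        \<open>p\<close>, where \<open>?e\<close> follows \<open>c\<close>; the upper end is
        symmetric, with \<open>d\<close>.\<close>
      have "lo c p = L b \<or> (\<exists>h\<in>P. ori ?e h \<noteq> b \<and> lo c p = coord b h \<and> spans ?e h p)"
      proof -
        have "ori ?e h \<noteq> b \<and> spans ?e h p"
          if "h \<in> P" "ori c h \<noteq> b" "lo c p = coord b h" "spans c h p" for h
          using that configsD(2)[OF c p] splice_less[OF that(1)] b by (simp add: spans_def)
        then show ?thesis using configsD(3)[OF c p] unfolding b by blast
      qed
      moreover have "hi d p = U b \<or> (\<exists>h\<in>P. ori ?e h \<noteq> b \<and> hi d p = coord b h \<and> spans ?e h p)"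
      proof -
        have "ori ?e h \<noteq> b \<and> spans ?e h p"
          if "h \<in> P" "ori d h \<noteq> b" "hi d p = coord b h" "spans d h p" for h
          using that configsD(2)[OF d p] splice_greater[OF that(1)] b by (simp add: spans_def)
        then show ?thesis using configsD(4)[OF d p] unfolding b by blast
      qed
      ultimately show ?thesis by (simp add: q splice_self)
    qed
  qed
  have nocross: "\<not> (spans ?e h q \<and> spans ?e q h)"
    if q: "q \<in> P" "ori c q \<noteq> b" and h: "h \<in> P" "ori c h = b" for q h
  proof -
    obtain f where f: "f \<in> {c, d}" "f \<in> configs L U P" "?e q = f q"
      "\<forall>h\<in>P. ori c h = b \<longrightarrow> spans ?e h q = spans f h q"
      using side[OF q] by blast
    have "ori f q = ori c q" "ori f h = ori c h"
      using f(1) q h by (auto simp: ori_eq)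
    then have "\<not> (spans f h q \<and> spans f q h)"
      using configsD(5)[OF f(2) q(1) h(1)] q h by metis
    then show ?thesis using f h by (auto simp: spans_def)
  qed
  have "\<not> (spans ?e h q \<and> spans ?e q h)"
    if "q \<in> P" "h \<in> P" "ori ?e h \<noteq> ori ?e q" for q h
    using nocross[of q h] nocross[of h q] that by (auto simp: splice_ori)
  moreover have "?e \<in> extensional P" by (simp add: splice_def)
  moreover have "spans ?e q q" if "q \<in> P" for q
    using configsD(2)[OF c that] configsD(2)[OF d that] b
    by (cases rule: splice_cases[OF that])
      (auto simp: spans_def splice_self splice_less[OF that] splice_greater[OF that])
  ultimately show ?thesis using ends unfolding configs_def by blast
qed

text \<open>The obstacles of a perpendicular segment have direction \<open>b\<close> and exclude
  \<open>p\<close>, hence are common to \<open>c\<close>, \<open>d\<close> and the splice. Each such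
  segment is prolonged as in its configuration of origin, and the deletions of \<open>c\<close> and
  \<open>d\<close> agree.\<close>

lemma remove_splice: "remove_pt p (splice p c d) = remove_pt p c"
proof (rule extensionalityI[of _ "P - {p}"])
  let ?e = "splice p c d"
  fix q assume q: "q \<in> P - {p}"
  then have qP: "q \<in> P" by simp
  show "remove_pt p ?e q = remove_pt p c q"
  proof (cases "ori c q = b")
    case True
    then show ?thesis
      using remove_pt_parallel[OF splice_in_configs p q] remove_pt_parallel[OF c p q]
        parallel_eq[OF q True] qP b p by (simp add: splice_ori)
  next
    case False
    have "?e q = f q \<Longrightarrow> f \<in> {c, d} \<Longrightarrow> remove_pt p ?e q = remove_pt p f q" for f
    proof -
      assume f: "?e q = f q" "f \<in> {c, d}"
      have "?e h = f h" if "h \<in> P - {p}" "ori c h = b" for h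
        using parallel_eq[OF that] f(2) by auto
      moreover have "ori ?e h = ori c h" "ori f h = ori c h" if "h \<in> P" for h
        using f(2) that by (auto simp: splice_ori ori_eq)
      ultimately have "{h \<in> P - {p}. ori ?e h \<noteq> ori f q \<and> Q h \<and> spans ?e h q} =
          {h \<in> P - {p}. ori f h \<noteq> ori f q \<and> Q h \<and> spans f h q}" for Q
        using False qP by (auto simp: spans_def)
      then have "below ?e p q = below f p q" "above ?e p q = above f p q"
        unfolding below_def above_def f(1) by simp_all
      then show ?thesis using q f(1) by (simp add: prod_eq_iff remove_pt_simps)
    qed
    from this[of c] this[of d] show ?thesis
      using splice_less[OF qP] splice_greater[OF qP] q r
      by (cases rule: splice_cases[OF qP]) auto
  qed
qed (auto simp: remove_pt_def)

lemma splice_degrees: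
  "deg_lo p (splice p c d) = deg_lo p c" "deg_hi p (splice p c d) = deg_hi p d"
  by (simp_all add: deg_lo_def deg_hi_def crossed_def remove_splice splice_self b r)

end

section \<open>Summing over the fibres of a deletion\<close>

text \<open>\<open>sum_product_image_le\<close> applies to the two counts: they determine the ends
  of the segment of \<open>p\<close> and with them \<open>c\<close>, and splicing combines the lower
  count of one configuration with the upper count of another.\<close>

lemma fibre_sum_le:
  assumes p: "p \<in> P"
  shows "(\<Sum>c | c \<in> configs L U P \<and> remove_pt p c = c' \<and> ori c p = b. 4 - int (degree c p)) \<le> 18"
proof -
  let ?F = "{c. c \<in> configs L U P \<and> remove_pt p c = c' \<and> ori c p = b}"
  have "(\<Sum>c\<in>?F. 4 - int (degree c p)) = (\<Sum>c\<in>?F. 4 - int (deg_lo p c + deg_hi p c))"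
    by (rule sum.cong) (auto simp: degree_split p)
  also have "\<dots> \<le> 18"
  proof (rule sum_product_image_le)
    show "finite ?F" by (rule finite_subset[OF _ finite_configs]) auto
    show "inj_on (\<lambda>c. (deg_lo p c, deg_hi p c)) ?F"
    proof (rule inj_onI)
      fix c d assume cd: "c \<in> ?F" "d \<in> ?F" "(deg_lo p c, deg_hi p c) = (deg_lo p d, deg_hi p d)"
      then have c: "c \<in> configs L U P" and d: "d \<in> configs L U P"
        and o: "ori c p = ori d p" and r: "remove_pt p c = remove_pt p d"
        and deg: "deg_lo p c = deg_lo p d" "deg_hi p c = deg_hi p d" by simp_all
      have cross: "crossed c p = crossed d p" by (simp add: crossed_def o r)
      have "lo c p = lo d p"
        using deg_lo_less[OF c d p cross o] deg_lo_less[OF d c p cross[symmetric] o[symmetric]] deg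
        by linarith
      moreover have "hi c p = hi d p"
        using deg_hi_less[OF c d p cross o] deg_hi_less[OF d c p cross[symmetric] o[symmetric]] deg
        by linarith
      ultimately show "c = d"
        using o by (intro config_eqI[OF c d p r]) (simp add: prod_eq_iff)
    qed
    fix c d assume "c \<in> ?F" "d \<in> ?F"
    then have "splice p c d \<in> ?F"
        "deg_lo p (splice p c d) = deg_lo p c" "deg_hi p (splice p c d) = deg_hi p d"
      using splice_in_configs[of c d p b] remove_splice[of c d p b] splice_degrees[of c d p b]
        splice_ori[of c d p b p] p by auto
    then show "\<exists>e\<in>?F. deg_lo p e = deg_lo p c \<and> deg_hi p e = deg_hi p d" by blast
  qed
  finally show ?thesis .
qed

lemma sum_degree_deficit_le:
  assumes p: "p \<in> P"
  shows "(\<Sum>c\<in>configs L U P. 4 - int (degree c p)) \<le> 36 * int (card (configs L U (P - {p})))"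
proof -
  interpret R: points_in_box "P - {p}" L U by (rule remove)
  let ?g = "\<lambda>c. (remove_pt p c, ori c p)"
  let ?T = "configs L U (P - {p}) \<times> (UNIV :: bool set)"
  have "(\<Sum>c\<in>configs L U P. 4 - int (degree c p)) =
      (\<Sum>y\<in>?T. \<Sum>c | c \<in> configs L U P \<and> ?g c = y. 4 - int (degree c p))"
    by (rule sum.group[symmetric])
      (auto simp: finite_configs R.finite_configs remove_pt_in_configs p)
  also have "\<dots> \<le> (\<Sum>y\<in>?T. 18)"
  proof (rule sum_mono)
    fix y :: "config \<times> bool"
    show "(\<Sum>c | c \<in> configs L U P \<and> ?g c = y. 4 - int (degree c p)) \<le> 18"
      using fibre_sum_le[OF p, of "fst y" "snd y"] by (simp add: prod_eq_iff)
  qed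
  also have "\<dots> = 36 * int (card (configs L U (P - {p})))"
    by (simp add: card_cartesian_product)
  finally show ?thesis .
qed

end

section \<open>Induction on the number of points\<close>

theorem card_configs_le:
  assumes "points_in_box P L U"
  shows "card (configs L U P) \<le> 18 ^ card P"
  using assms
proof (induction "card P" arbitrary: P)
  case 0
  then interpret points_in_box P L U by simp
  have "P = {}" using 0 fin by simp
  then have "configs L U P \<subseteq> {\<lambda>_. undefined}" by (auto simp: configs_def)
  then have "card (configs L U P) \<le> card {\<lambda>_ :: real \<times> real. undefined :: bool \<times> real \<times> real}"
    by (intro card_mono) auto
  then show ?case using \<open>P = {}\<close> by simp
next
  case (Suc n)
  then interpret points_in_box P L U by simp
  let ?N = "int (card (configs L U P))"
  have n: "card P = Suc n" using Suc by simp
  have "2 * int (Suc n) * ?N = (\<Sum>c\<in>configs L U P. 4 * int (Suc n) - 2 * int (card P))"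
    by (simp add: n algebra_simps)
  \<comment> \<open>The degrees use up at most \<open>2 * card P\<close> of the total
    \<open>4 * card P\<close>. Single terms \<open>4 - degree c p\<close> may be negative, hence
    \<open>int\<close>.\<close>
  also have "\<dots> \<le> (\<Sum>c\<in>configs L U P. \<Sum>p\<in>P. 4 - int (degree c p))"
  proof (rule sum_mono)
    fix c
    show "4 * int (Suc n) - 2 * int (card P) \<le> (\<Sum>p\<in>P. 4 - int (degree c p))"
      using sum_degree_le[of c] n by (simp add: sum_subtractf flip: of_nat_sum)
  qed
  also have "\<dots> = (\<Sum>p\<in>P. \<Sum>c\<in>configs L U P. 4 - int (degree c p))"
    by (rule sum.swap)
  also have "\<dots> \<le> (\<Sum>p\<in>P. 36 * 18 ^ n)"
  proof (rule sum_mono)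
    fix p assume p: "p \<in> P"
    have "card (P - {p}) = n" using n p fin by simp
    then have "card (configs L U (P - {p})) \<le> 18 ^ n"
      using Suc(1)[of "P - {p}"] remove by metis
    then have "int (card (configs L U (P - {p}))) \<le> 18 ^ n"
      by (metis of_nat_le_iff of_nat_numeral of_nat_power)
    then show "(\<Sum>c\<in>configs L U P. 4 - int (degree c p)) \<le> 36 * 18 ^ n"
      using sum_degree_deficit_le[OF p] by linarith
  qed
  also have "\<dots> = 2 * int (Suc n) * 18 ^ Suc n" by (simp add: n)
  finally have "?N \<le> 18 ^ Suc n" by (subst (asm) mult_le_cancel_left_pos) auto
  then show ?case unfolding n by (metis of_nat_le_iff of_nat_numeral of_nat_power)
qed

subsection \<open>From tilings to configurations\<close>

text \<open>A nondegenerate tile is the closure of its interior, so an open set that meets its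
  frontier meets its interior too; interiors of distinct tiles are disjoint.\<close>

lemma tile_frontier_not_interior:
  assumes T: "T division_of B" and rect: "\<forall>R\<in>T. rectangle R"
    and e: "e \<in> (\<Union>R\<in>T. frontier R)" and R: "R \<in> T"
  shows "e \<notin> interior R"
proof
  assume eR: "e \<in> interior R"
  obtain Q where Q: "Q \<in> T" "e \<in> frontier Q" using e by blast
  then have "Q \<noteq> R" using eR unfolding frontier_def by blast
  have "rectangle Q" using rect Q(1) by (rule bspec)
  then obtain a b where ab: "Q = cbox a b" "interior Q \<noteq> {}"
    unfolding rectangle_def by (elim conjE exE)
  have "closure (interior Q) = Q" using ab(2) unfolding ab(1) interior_cbox by (rule closure_box)
  moreover have "e \<in> Q" using Q(2) by (simp add: frontier_def ab(1))
  ultimately have "interior R \<inter> interior Q \<noteq> {}"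
    using eR open_Int_closure_eq_empty[OF open_interior, of R "interior Q"] by blast
  then show False using division_ofD(5)[OF T R Q(1)] \<open>Q \<noteq> R\<close> by blast
qed

text \<open>A connected set that avoids all frontiers stays inside one tile. By convexity the
  interior of this tile would contain \<open>e\<close>, the midpoint of \<open>e - v\<close> and
  \<open>e + v\<close>.\<close>

lemma antipodal_path_meets_frontier:
  assumes T: "T division_of B" and rect: "\<forall>R\<in>T. rectangle R"
    and e: "e \<in> (\<Union>R\<in>T. frontier R)"
    and K: "connected K" "K \<subseteq> B" "e - v \<in> K" "e + v \<in> K"
  shows "K \<inter> (\<Union>R\<in>T. frontier R) \<noteq> {}"
proof
  assume disj: "K \<inter> (\<Union>R\<in>T. frontier R) = {}"
  obtain R where R: "R \<in> T" "e - v \<in> R"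
    using K division_ofD(6)[OF T] by blast
  then have "K \<subseteq> R"
    using connected_Int_frontier[OF K(1), of R] K(3) disj by blast
  moreover obtain a b where ab: "R = cbox a b" using rect R(1) unfolding rectangle_def by blast
  moreover have "frontier R = R - interior R" by (simp add: ab frontier_def)
  ultimately have "K \<subseteq> interior R" using disj R(1) by blast
  then have "e - v \<in> interior R" "e + v \<in> interior R" using K by auto
  moreover have "convex (interior R)" by (simp add: ab)
  ultimately have "(1/2) *\<^sub>R (e - v) + (1/2) *\<^sub>R (e + v) \<in> interior R"
    by (intro convexD) auto
  moreover have "(1/2) *\<^sub>R (e - v) + (1/2) *\<^sub>R (e + v) = e"
    by (simp flip: scaleR_right_distrib scaleR_2)
  ultimately have "e \<in> interior R" by simp
  then show False using tile_frontier_not_interior[OF T rect e R(1)] by blast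
qed

section \<open>Axis-parallel segments in coordinates\<close>

definition pt :: "bool \<Rightarrow> real \<Rightarrow> real \<Rightarrow> real \<times> real" where
  "pt b u v = (if b then (u, v) else (v, u))"

lemma coord_pt [simp]: "coord b (pt b u v) = u" "coord (\<not> b) (pt b u v) = v"
  by (simp_all add: coord_def pt_def)

lemma coord_arith [simp]:
  "coord b (x + y) = coord b x + coord b y" "coord b (x - y) = coord b x - coord b y"
  "coord b (r *\<^sub>R x) = r * coord b x"
  by (simp_all add: coord_def)

lemma eq_pt_iff: "x = pt b u v \<longleftrightarrow> coord b x = u \<and> coord (\<not> b) x = v"
  by (cases x) (auto simp: coord_def pt_def)

lemma mem_cbox_coord: "x \<in> cbox a c \<longleftrightarrow> (\<forall>b. coord b a \<le> coord b x \<and> coord b x \<le> coord b c)"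
  by (simp add: coord_def cbox_prod mem_Times_iff all_bool_eq conj_ac)

lemma mem_box_coord: "x \<in> box a c \<longleftrightarrow> (\<forall>b. coord b a < coord b x \<and> coord b x < coord b c)"
  by (simp add: coord_def box_prod mem_Times_iff all_bool_eq conj_ac)

definition segment :: "bool \<Rightarrow> real \<Rightarrow> real \<Rightarrow> real \<Rightarrow> (real \<times> real) set" where
  "segment b y l h = {x. coord (\<not> b) x = y \<and> l \<le> coord b x \<and> coord b x \<le> h}"

lemma segment_eq:
  assumes "l \<le> h"
  shows "segment b y l h = closed_segment (pt b l y) (pt b h y)"
proof (intro equalityI subsetI)
  fix x assume x: "x \<in> segment b y l h"
  then have "coord b x \<in> closed_segment l h"
    using assms by (simp add: segment_def closed_segment_eq_real_ivl)
  then obtain t where "0 \<le> t" "t \<le> 1" "coord b x = (1 - t) * l + t * h"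
    by (auto simp: in_segment)
  moreover have "x = (1 - t) *\<^sub>R pt b l y + t *\<^sub>R pt b h y"
    using x calculation(3) by (cases x; cases b) (auto simp: segment_def pt_def coord_def algebra_simps)
  ultimately show "x \<in> closed_segment (pt b l y) (pt b h y)" by (auto simp: in_segment)
next
  fix x assume "x \<in> closed_segment (pt b l y) (pt b h y)"
  then obtain t where t: "0 \<le> t" "t \<le> 1" "x = (1 - t) *\<^sub>R pt b l y + t *\<^sub>R pt b h y"
    by (auto simp: in_segment)
  then have "coord b x \<in> closed_segment l h" by (auto simp: in_segment)
  moreover have "coord (\<not> b) x = y" by (simp add: t(3) algebra_simps)
  ultimately show "x \<in> segment b y l h"
    using assms by (simp add: segment_def closed_segment_eq_real_ivl)
qed

lemma rel_interior_segment:
  assumes "l < h"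
  shows "rel_interior (segment b y l h) =
    {x. coord (\<not> b) x = y \<and> l < coord b x \<and> coord b x < h}"
proof -
  have "pt b l y \<noteq> pt b h y" using assms by (auto simp: pt_def)
  then have "rel_interior (segment b y l h) = open_segment (pt b l y) (pt b h y)"
    using assms by (simp add: segment_eq rel_interior_closed_segment)
  also have "\<dots> = segment b y l h - {pt b l y, pt b h y}"
    using assms by (simp add: segment_eq open_segment_def)
  also have "\<dots> = {x. coord (\<not> b) x = y \<and> l < coord b x \<and> coord b x < h}"
    by (auto simp: segment_def eq_pt_iff)
  finally show ?thesis .
qed

lemma axis_parallel_segmentD:
  assumes "axis_parallel_segment s"
  shows "\<exists>b y l h. l < h \<and> s = segment b y l h"
proof -
  obtain p q where s: "s = closed_segment p q" "p \<noteq> q" "fst p = fst q \<or> snd p = snd q"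
    using assms by (auto simp: axis_parallel_segment_def)
  define b where "b = (snd p = snd q)"
  have eq: "coord (\<not> b) p = coord (\<not> b) q" using s(3) by (auto simp: b_def coord_def)
  then have p: "p = pt b (coord b p) (coord (\<not> b) p)" and q: "q = pt b (coord b q) (coord (\<not> b) p)"
    by (simp_all add: eq_pt_iff)
  have "coord b p \<noteq> coord b q" using p q s(2) by metis
  then consider "coord b p < coord b q" | "coord b q < coord b p" by linarith
  then show ?thesis
  proof cases
    case 1
    then have "s = segment b (coord (\<not> b) p) (coord b p) (coord b q)"
      using s(1) p q by (simp add: segment_eq)
    with 1 show ?thesis by blast
  next
    case 2
    then have "s = segment b (coord (\<not> b) p) (coord b q) (coord b p)"
      using s(1) p q by (simp add: segment_eq closed_segment_commute)
    with 2 show ?thesis by blast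
  qed
qed

lemma dist_le_coord: "dist x y \<le> \<bar>coord b x - coord b y\<bar> + \<bar>coord (\<not> b) x - coord (\<not> b) y\<bar>"
  using sqrt_sum_squares_le_sum_abs[of "fst x - fst y" "snd x - snd y"]
  by (cases b) (auto simp: dist_prod_def dist_real_def coord_def)

text \<open>
  If all segments through an interior point \<open>e\<close> stay in one closed quadrant at \<open>e\<close>, then an
  L-shaped path around the other three quadrants lies in a single tile; by convexity \<open>e\<close> is
  interior to that tile.
\<close>

lemma quadrant_contradiction:
  assumes T: "T division_of B" and rect: "\<forall>R\<in>T. rectangle R"
    and F: "(\<Union>R\<in>T. frontier R) = frontier B \<union> \<Union>S"
    and S: "finite S" "\<And>s. s \<in> S \<Longrightarrow> closed s"
    and e: "e \<in> interior B" "e \<in> \<Union>S"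
    and \<sigma>: "\<sigma> = 1 \<or> \<sigma> = -1" and \<tau>: "\<tau> = 1 \<or> \<tau> = -1"
    and quadrant: "\<And>s x. s \<in> S \<Longrightarrow> e \<in> s \<Longrightarrow> x \<in> s \<Longrightarrow>
       \<sigma> * (coord b x - coord b e) \<le> 0 \<and> \<tau> * (coord (\<not> b) x - coord (\<not> b) e) \<le> 0"
  shows False
proof -
  \<comment> \<open>An open neighbourhood of \<open>e\<close> in which a frontier point of a tile
    can only lie on a segment through \<open>e\<close>.\<close>
  define D where "D = - (frontier B \<union> \<Union>{s \<in> S. e \<notin> s}) \<inter> interior B"
  have "closed (\<Union>{s \<in> S. e \<notin> s})" using S by (intro closed_Union) auto
  then have "open D" by (auto simp: D_def intro!: open_Int open_Compl closed_Un)
  moreover have "e \<in> D" using e(1) by (auto simp: D_def frontier_def)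
  ultimately obtain \<epsilon> where \<epsilon>: "\<epsilon> > 0" "ball e \<epsilon> \<subseteq> D" by (auto simp: open_contains_ball)
  define \<delta> where "\<delta> = \<epsilon> / 3"
  have \<delta>: "\<delta> > 0" using \<epsilon> by (simp add: \<delta>_def)
  define u v where "u = coord b e" and "v = coord (\<not> b) e"
  \<comment> \<open>Two arms outside the quadrant, joined at the corner opposite to it; their free
    ends are \<open>e - w\<close> and \<open>e + w\<close>. Taxicab distances from \<open>e\<close>
    are at most \<open>2 * \<delta> < \<epsilon>\<close>.\<close>
  define K1 where "K1 = segment b (v + \<tau> * \<delta>) (u - \<delta>) (u + \<delta>)"
  define K2 where "K2 = segment (\<not> b) (u + \<sigma> * \<delta>) (v - \<delta>) (v + \<delta>)"
  define w where "w = pt b (\<sigma> * \<delta>) (- \<tau> * \<delta>)"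
  have "pt b (u + \<sigma> * \<delta>) (v + \<tau> * \<delta>) \<in> K1 \<inter> K2"
    using \<sigma> \<tau> \<delta> by (auto simp: K1_def K2_def segment_def)
  moreover have "connected K1" "connected K2"
    using \<delta> by (simp_all add: K1_def K2_def segment_eq)
  ultimately have "connected (K1 \<union> K2)" by (intro connected_Un) auto
  moreover have near: "K1 \<union> K2 \<subseteq> D"
  proof
    fix x assume "x \<in> K1 \<union> K2"
    then have "\<bar>coord b e - coord b x\<bar> \<le> \<delta>" "\<bar>coord (\<not> b) e - coord (\<not> b) x\<bar> \<le> \<delta>"
      using \<sigma> \<tau> \<delta> by (auto simp: K1_def K2_def segment_def u_def v_def)
    then have "dist e x < \<epsilon>" using dist_le_coord[of e x b] \<delta> by (simp add: \<delta>_def)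
    with \<epsilon>(2) show "x \<in> D" by auto
  qed
  moreover have "D \<subseteq> B" using interior_subset by (auto simp: D_def)
  moreover have "e - w \<in> K1" "e + w \<in> K2"
    using \<sigma> \<tau> \<delta> by (auto simp: K1_def K2_def segment_def w_def u_def v_def)
  ultimately have "(K1 \<union> K2) \<inter> (\<Union>R\<in>T. frontier R) \<noteq> {}"
    using e(2) F by (intro antipodal_path_meets_frontier[OF T rect, of e _ w]) auto
  then obtain x s where x: "x \<in> K1 \<union> K2" "x \<in> s" "s \<in> S" "e \<in> s"
    using near unfolding F D_def by blast
  have "\<sigma> * (coord b x - u) = \<delta> \<or> \<tau> * (coord (\<not> b) x - v) = \<delta>"
    using x(1) \<sigma> \<tau> by (auto simp: K1_def K2_def segment_def)
  then show False using quadrant[OF x(3,4,2)] \<delta> by (auto simp: u_def v_def)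
qed

lemma points_in_boxI:
  assumes "general_position P" and inside: "P \<subseteq> interior (cbox a c)"
  shows "points_in_box P (\<lambda>b. coord b a) (\<lambda>b. coord b c)"
proof
  show "finite P" using assms by (simp add: general_position_def)
  show "inj_on (coord b) P" for b
    using assms by (auto simp: general_position_def coord_def inj_on_def)
  show "coord b a < coord b q \<and> coord b q < coord b c" if "q \<in> P" for b q
    using subsetD[OF inside that] by (simp only: interior_cbox mem_box_coord)
qed

section \<open>From a rectangulation to its configuration\<close>

locale rectangulated =
  fixes a c :: "real \<times> real" and P :: "(real \<times> real) set" and S :: "(real \<times> real) set set"
  assumes gp: "general_position P" and inside: "P \<subseteq> interior (cbox a c)"
    and rectangulation: "rectangulation (cbox a c) P S"
begin

abbreviation L :: "bool \<Rightarrow> real" where "L b \<equiv> coord b a"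
abbreviation U :: "bool \<Rightarrow> real" where "U b \<equiv> coord b c"

sublocale points_in_box P L U
  using gp inside by (rule points_in_boxI)

lemma parallel: "s \<in> S \<Longrightarrow> axis_parallel_segment s"
  and partition: "partitions_into_rectangles S (cbox a c)"
  and ex1_point: "s \<in> S \<Longrightarrow> \<exists>!p. p \<in> P \<and> p \<in> s"
  and ex1_segment: "p \<in> P \<Longrightarrow> \<exists>!s. s \<in> S \<and> p \<in> s"
  and disjoint: "s \<in> S \<Longrightarrow> t \<in> S \<Longrightarrow> s \<noteq> t \<Longrightarrow> rel_interior s \<inter> rel_interior t = {}"
  using rectangulation by (simp_all add: rectangulation_def)

definition seg :: "config \<Rightarrow> real \<times> real \<Rightarrow> (real \<times> real) set" where
  "seg k q = segment (ori k q) (coord (\<not> ori k q) q) (lo k q) (hi k q)"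

lemma ex_segment: "\<exists>k. k \<in> extensional P \<and> (\<forall>q\<in>P. seg k q \<in> S \<and> q \<in> seg k q \<and> lo k q < hi k q)"
proof -
  have "\<exists>b l h. segment b (coord (\<not> b) q) l h \<in> S \<and> q \<in> segment b (coord (\<not> b) q) l h \<and> l < h"
    if q: "q \<in> P" for q
  proof -
    obtain s where s: "s \<in> S" "q \<in> s"
      using ex1_segment[OF q] by blast
    then obtain b y l h where "l < h" "s = segment b y l h"
      using axis_parallel_segmentD[OF parallel] by blast
    moreover have "y = coord (\<not> b) q" using s(2) calculation(2) by (simp add: segment_def)
    ultimately show ?thesis using s by blast
  qed
  then obtain b l h where k: "\<forall>q\<in>P. segment (b q) (coord (\<not> b q) q) (l q) (h q) \<in> S \<and>
      q \<in> segment (b q) (coord (\<not> b q) q) (l q) (h q) \<and> l q < h q"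
    by metis
  then have "(\<lambda>q\<in>P. (b q, l q, h q)) \<in> extensional P \<and>
     (\<forall>q\<in>P. seg (\<lambda>q\<in>P. (b q, l q, h q)) q \<in> S \<and> q \<in> seg (\<lambda>q\<in>P. (b q, l q, h q)) q \<and>
        lo (\<lambda>q\<in>P. (b q, l q, h q)) q < hi (\<lambda>q\<in>P. (b q, l q, h q)) q)"
    by (simp add: seg_def)
  then show ?thesis by blast
qed

context
  fixes k
  assumes k: "k \<in> extensional P"
    and seg: "\<And>q. q \<in> P \<Longrightarrow> seg k q \<in> S" "\<And>q. q \<in> P \<Longrightarrow> q \<in> seg k q"
      "\<And>q. q \<in> P \<Longrightarrow> lo k q < hi k q"
begin

lemma seg_unique: "q \<in> P \<Longrightarrow> h \<in> P \<Longrightarrow> q \<in> seg k h \<Longrightarrow> q = h"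
  using ex1_point[OF seg(1)] seg(2) by blast

lemma segments_eq: "S = seg k ` P"
proof (intro equalityI subsetI)
  fix s assume s: "s \<in> S"
  then obtain q where q: "q \<in> P" "q \<in> s" using ex1_point by blast
  then have "s = seg k q"
    using ex1_segment[OF q(1)] seg(1,2)[of q] s by blast
  then show "s \<in> seg k ` P" using q by blast
qed (use seg in auto)

lemma seg_subset_box: "q \<in> P \<Longrightarrow> seg k q \<subseteq> cbox a c"
proof -
  assume q: "q \<in> P"
  obtain T where T: "T division_of cbox a c"
      "(\<Union>R\<in>T. frontier R) = frontier (cbox a c) \<union> \<Union>S"
    using partition unfolding partitions_into_rectangles_def by blast
  have "frontier R \<subseteq> R" if "R \<in> T" for R
    using division_ofD(4)[OF T(1) that] by (auto simp: frontier_def)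
  then show ?thesis using T(2) division_ofD(6)[OF T(1)] seg(1)[OF q] by blast
qed

text \<open>Otherwise every segment through the end \<open>e\<close> lies in one closed quadrant: in
  direction \<open>b\<close> only that of \<open>q\<close>, by general position, and across it at
  most one, which must end at \<open>e\<close> because it does not span \<open>q\<close>. This is
  what \<open>quadrant_contradiction\<close> excludes.\<close>

lemma interior_end:
  assumes q: "q \<in> P" and x: "x = lo k q \<or> x = hi k q"
    and in_box: "L (ori k q) < x" "x < U (ori k q)"
  shows "\<exists>h\<in>P. ori k h \<noteq> ori k q \<and> x = coord (ori k q) h \<and> spans k h q"
proof (rule ccontr)
  assume none: "\<not> ?thesis"
  define b y e where "b = ori k q" and "y = coord (\<not> b) q" and "e = pt b x y"
  have e_seg: "e \<in> seg k q"
    using x seg(3)[OF q] by (auto simp: e_def seg_def segment_def b_def y_def)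
  have e_int: "e \<in> interior (cbox a c)"
  proof -
    have "L d < coord d e \<and> coord d e < U d" for d
      using in_box bounds[OF q, of d] by (cases "d = b") (auto simp: e_def y_def b_def)
    then show ?thesis by (simp add: interior_cbox mem_box_coord)
  qed
  obtain T where T: "T division_of cbox a c" "\<forall>R\<in>T. rectangle R"
      "(\<Union>R\<in>T. frontier R) = frontier (cbox a c) \<union> \<Union>S"
    using partition unfolding partitions_into_rectangles_def by blast
  have "finite S" by (simp add: segments_eq fin)
  have closed: "closed s" if s: "s \<in> S" for s
  proof -
    obtain h where "h \<in> P" "s = seg k h" using s unfolding segments_eq by blast
    then show ?thesis using seg(3)[of h] by (simp add: seg_def segment_eq)
  qed
  \<comment> \<open>The signs point away from the segments: \<open>\<sigma>\<close> beyond the end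
    of that of \<open>q\<close>, \<open>\<tau>\<close> beyond the end of the perpendicular one, with
    -1 also when there is none.\<close>
  define \<sigma> :: real where "\<sigma> = (if x = lo k q then -1 else 1)"
  define \<tau> :: real where
    "\<tau> = (if \<exists>h\<in>P. ori k h \<noteq> b \<and> coord b h = x \<and> hi k h = y then 1 else -1)"
  have quadrant: "\<sigma> * (coord b z - coord b e) \<le> 0 \<and> \<tau> * (coord (\<not> b) z - coord (\<not> b) e) \<le> 0"
    if s: "s \<in> S" "e \<in> s" "z \<in> s" for s z
  proof -
    obtain h where h: "h \<in> P" "s = seg k h" using s unfolding segments_eq by blast
    show ?thesis
    proof (cases "ori k h = b")
      case True
      then have "coord (\<not> b) h = y" using s(2) h by (simp add: seg_def segment_def e_def)
      then have "h = q" using coord_eqD[of "\<not> b" h q] h q by (simp add: y_def)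
      then show ?thesis
        using s(3) h x by (auto simp: seg_def segment_def \<sigma>_def e_def b_def y_def)
    next
      case False
      then have o: "ori k h = (\<not> b)" by simp
      have xh: "coord b h = x" "lo k h \<le> y" "y \<le> hi k h"
        using s(2) h o by (auto simp: seg_def segment_def e_def)
      have z: "coord b z = x" "lo k h \<le> coord (\<not> b) z" "coord (\<not> b) z \<le> hi k h"
        using s(3) h o xh(1) by (auto simp: seg_def segment_def)
      have "\<not> spans k h q" using none h o xh(1) by (auto simp: b_def)
      then have "y = lo k h \<or> y = hi k h"
        using xh o by (auto simp: spans_def y_def)
      moreover have "hi k h = y" if \<tau>: "\<tau> = 1"
      proof -
        obtain h' where "h' \<in> P" "coord b h' = x" "hi k h' = y"
          using \<tau> by (auto simp: \<tau>_def split: if_splits)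
        then show ?thesis using coord_eqD[of b h' h] h xh by auto
      qed
      moreover have "hi k h \<noteq> y" if "\<tau> \<noteq> 1"
        using that h o xh(1) by (auto simp: \<tau>_def split: if_splits)
      moreover have "\<tau> = 1 \<or> \<tau> = -1" by (simp add: \<tau>_def)
      ultimately have "(\<tau> = 1 \<and> hi k h = y) \<or> (\<tau> = -1 \<and> lo k h = y)" by metis
      then show ?thesis using z by (auto simp: e_def)
    qed
  qed
  show False
  proof (rule quadrant_contradiction[OF T \<open>finite S\<close> _ e_int, of \<sigma> \<tau> b])
    show "e \<in> \<Union>S" using e_seg seg(1)[OF q] by blast
    show "\<sigma> = 1 \<or> \<sigma> = -1" "\<tau> = 1 \<or> \<tau> = -1" by (simp_all add: \<sigma>_def \<tau>_def)
  qed (fact closed quadrant)+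
qed

lemma in_configs: "k \<in> configs L U P"
proof -
  have ends: "(lo k q = L (ori k q) \<or>
       (\<exists>h\<in>P. ori k h \<noteq> ori k q \<and> lo k q = coord (ori k q) h \<and> spans k h q)) \<and>
     (hi k q = U (ori k q) \<or>
       (\<exists>h\<in>P. ori k h \<noteq> ori k q \<and> hi k q = coord (ori k q) h \<and> spans k h q)) \<and>
     spans k q q" if q: "q \<in> P" for q
  proof -
    let ?b = "ori k q"
    have mem: "lo k q \<le> coord ?b q" "coord ?b q \<le> hi k q"
      using seg(2)[OF q] by (auto simp: seg_def segment_def)
    have "pt ?b x (coord (\<not> ?b) q) \<in> cbox a c" if "x = lo k q \<or> x = hi k q" for x
      using seg_subset_box[OF q] seg(3)[OF q] that by (auto simp: seg_def segment_def)
    then have box: "L ?b \<le> x \<and> x \<le> U ?b" if "x = lo k q \<or> x = hi k q" for x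
      using that unfolding mem_cbox_coord by (metis coord_pt(1))
    have "L ?b < coord ?b q" "coord ?b q < U ?b" using bounds[OF q] by auto
    then have lo: "lo k q = L ?b \<or> (L ?b < lo k q \<and> lo k q < U ?b)"
      and hi: "hi k q = U ?b \<or> (L ?b < hi k q \<and> hi k q < U ?b)"
      using mem box by fastforce+
    \<comment> \<open>If \<open>q\<close> were an end of its segment, it would by
      \<open>interior_end\<close> share a coordinate with a point of the other orientation, against
      general position.\<close>
    have "coord ?b q \<noteq> x" if "x = lo k q \<or> x = hi k q" for x
      using interior_end[OF q that] bounds[OF q, of ?b] coord_eqD[of ?b q] q by metis
    from this[of "lo k q"] this[of "hi k q"] mem have "spans k q q"
      by (auto simp: spans_def less_le)
    then show ?thesis using lo hi interior_end[OF q, of "lo k q"] interior_end[OF q, of "hi k q"]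
      by blast
  qed
  have "\<not> (spans k h q \<and> spans k q h)" if q: "q \<in> P" and h: "h \<in> P" and o: "ori k h \<noteq> ori k q" for q h
  proof
    assume sp: "spans k h q \<and> spans k q h"
    define z where "z = pt (ori k q) (coord (ori k q) h) (coord (ori k h) q)"
    have o': "ori k h = (\<not> ori k q)" using o by simp
    have "z \<in> rel_interior (seg k q) \<inter> rel_interior (seg k h)"
      using sp o' seg(3)[OF q] seg(3)[OF h]
      by (simp add: seg_def rel_interior_segment spans_def z_def)
    moreover have "seg k q \<noteq> seg k h" using seg_unique[OF q h] seg(2)[OF q] o by auto
    ultimately show False
      using disjoint[OF seg(1)[OF q] seg(1)[OF h]] by blast
  qed
  then show ?thesis using ends k unfolding configs_def by blast
qed

end

end

text \<open>The configuration of a rectangulation gives all its segments back. This transfers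
  finiteness and the bound on the cardinality from configurations.\<close>

lemma rectangulations_subset:
  assumes "general_position P" and "P \<subseteq> interior (cbox a c)"
  shows "{S. rectangulation (cbox a c) P S} \<subseteq>
    (\<lambda>k. (\<lambda>q. segment (ori k q) (coord (\<not> ori k q) q) (lo k q) (hi k q)) ` P) `
      configs (\<lambda>b. coord b a) (\<lambda>b. coord b c) P"
proof
  fix S assume "S \<in> {S. rectangulation (cbox a c) P S}"
  then interpret rectangulated a c P S using assms by unfold_locales auto
  obtain k where "k \<in> extensional P" "\<forall>q\<in>P. seg k q \<in> S \<and> q \<in> seg k q \<and> lo k q < hi k q"
    using ex_segment by blast
  then have "k \<in> configs L U P" "S = seg k ` P" using in_configs[of k] segments_eq[of k] by blast+
  then show "S \<in> (\<lambda>k. (\<lambda>q. segment (ori k q) (coord (\<not> ori k q) q) (lo k q) (hi k q)) ` P) `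
      configs (\<lambda>b. coord b a) (\<lambda>b. coord b c) P"
    unfolding seg_def by blast
qed

lemma numeral_power_enat: "numeral k ^ n = enat (numeral k ^ n)"
  by (induction n) (simp_all add: numeral_eq_enat one_enat_def)

theorem theorem3p3:
  fixes n :: nat
  assumes "n \<ge> 1"
  shows "rc_max n \<le> 18 ^ n"
  unfolding rc_max_def
proof (rule Sup_least)
  fix x assume "x \<in> {rc B P | B P.
     rectangle B \<and> general_position P \<and> card P = n \<and> P \<subseteq> interior B}"
  then obtain B P where x: "x = rc B P" "rectangle B" "general_position P" "card P = n"
      "P \<subseteq> interior B"
    by blast
  then obtain a c where B: "B = cbox a c" unfolding rectangle_def by blast
  let ?C = "configs (\<lambda>b. coord b a) (\<lambda>b. coord b c) P"
  have inside: "P \<subseteq> interior (cbox a c)" using x(5) B by simp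
  have box: "points_in_box P (\<lambda>b. coord b a) (\<lambda>b. coord b c)"
    using x(3) inside by (rule points_in_boxI)
  have fin: "finite ?C" by (rule points_in_box.finite_configs[OF box])
  note sub = rectangulations_subset[OF x(3) inside, folded B]
  have "card {S. rectangulation B P S} \<le> card ?C"
    by (rule surj_card_le[OF fin sub])
  also have "\<dots> \<le> 18 ^ n" using card_configs_le[OF box] by (simp add: x(4))
  finally have "enat (card {S. rectangulation B P S}) \<le> 18 ^ n"
    by (simp add: numeral_power_enat)
  \<comment> \<open>Otherwise \<open>rc\<close> would be infinite, whatever the value of
    \<open>card\<close>.\<close>
  moreover have "finite {S. rectangulation B P S}"
    by (rule finite_subset[OF sub finite_imageI[OF fin]])
  ultimately show "x \<le> 18 ^ n" by (simp add: x(1) rc_def)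
qed

end
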